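(* Let $K$ be a field of characteristic $0$ and let $L\in K[z,\partial_z]$ be a nonzero differential operator. Assume $d:=\dim_K V_1(L)>0$. (i) For every positive integer $n$, the left ideal $I_n(L)$ is nonzero. (ii) Let $n$ be a positive integer, let $f_1,\ldots,f_d$ be a $K$-basis of $V_1(L)$, let $A(t)\in K[t]$, and let $R\in I_n(L)\setminus\{0\}$, with formal adjoint $R^*$. Define $$P(z):=\bigl(R^*\cdot A(t)\bigr)\big|_{t=z},\qquad Q_j(z):=\varphi_{f_j}\!\left(\frac{P(z)-P(t)}{z-t}\right)\quad(1\le j\le d).$$ Assume $P(z)\ne0$. Then the tuple of polynomials $(P,Q_1,\ldots,Q_d)$ is a weight $n$ Padé-type approximant of $(f_1,\ldots,f_d)$. (iii) In the situation of (ii), put $\mathfrak{R}_j(z):=P(z)f_j(z)-Q_j(z)$ for $1\le j\le d$. Then $$\mathfrak{R}_j(z)=\sum_{k=n}^{\infty}\frac{\varphi_{f_j}(t^kP(t))}{z^{k+1}}\qquad(1\le j\le d).$$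
   Context: $K[z,\partial_z]$ is the Weyl algebra of differential operators with polynomial coefficients, acting on the field $K((1/z))$ of formal Laurent series in $1/z$; $L\cdot f$ denotes the action. The order is $\mathrm{ord}_\infty(\sum_k a_kz^{-k})=\min\{k: a_k\ne0\}$ ($\infty$ for the zero series). The projection $\pi:K((1/z))\to \frac1zK[[1/z]]$ removes the polynomial part: writing $f=P+\tilde f$ with $P\in K[z]$, $\tilde f\in\frac1zK[[1/z]]$, $\pi(f)=\tilde f$. For $f=\sum_{k\ge0}f_k z^{-k-1}\in\frac1zK[[1/z]]$, $\varphi_f:K[t]\to K$ is the $K$-linear map $t^k\mapsto f_k$, extended $K[z]$-linearly to $K[z][t]$ (acting on the variable $t$). The formal adjoint of $R=\sum_jP_j(z)\partial_z^j$ is $R^*=\sum_j(-1)^j\partial_t^jP_j(t)\in K[t,\partial_t]$, acting on $K[t]$. $V_1(L)=\{f\in\frac1zK[[1/z]]: L\cdot f\in K[z]\}$ and $V_n(L)=\mathrm{Span}_K\{\pi(z^kf):0\le k\le n-1,\ f\in V_1(L)\}$. $I_n(L)=\{R\in K[z,\partial_z]: R\cdot f\in K[z]\text{ for all }f\in V_n(L)\}$. A tuple $(P,Q_1,\ldots,Q_d)\in K[z]^{d+1}$ is a weight $n$ Padé-type approximant of $(f_1,\ldots,f_d)$ if, for some integer $M\ge dn$, $\deg P\le M$ and $\mathrm{ord}_\infty(P(z)f_j(z)-Q_j(z))\ge n+1$ for all $1\le j\le d$. *)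

theory Defs
  imports
    "HOL-Computational_Algebra.Computational_Algebra"
    "HOL-Library.Extended"
begin

text \<open>
  The field \<open>K((1/z))\<close> is \<^typ>\<open>'a fls\<close>, whose formal variable \<^const>\<open>fls_X\<close> stands for \<open>1/z\<close>;
  hence \<open>z\<close> is \<^const>\<open>fls_X_inv\<close> and \<open>fls_nth f k\<close> is the coefficient of \<open>z\<^sup>-\<^sup>k\<close>.
\<close>

text \<open>\<^const>\<open>fls_subdegree\<close> is the least index of a nonzero coefficient, but sends 0 to 0.\<close>

definition ord_inf :: "'a::field_char_0 fls \<Rightarrow> int extended" where
  "ord_inf f = (if f = 0 then Pinf else Fin (fls_subdegree f))"

definition poly_fls :: "'a::field_char_0 poly \<Rightarrow> 'a fls" where
  "poly_fls P = poly (map_poly fls_const P) fls_X_inv"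

abbreviation polys :: "'a::field_char_0 fls set" where
  "polys \<equiv> range poly_fls"

definition zinv_series :: "'a::field_char_0 fls set" where
  "zinv_series = {f. \<forall>k\<le>0. fls_nth f k = 0}"

definition proj_inf :: "'a::field_char_0 fls \<Rightarrow> 'a fls" where
  "proj_inf f = fps_to_fls (fls_regpart f - fps_const (fls_nth f 0))"

text \<open>With \<open>x = 1/z\<close> one has \<open>d/dz = - x\<^sup>2 d/dx\<close>.\<close>

definition dz :: "'a::field_char_0 fls \<Rightarrow> 'a fls" where
  "dz f = - (fls_X ^ 2 * fls_deriv f)"

global_interpretation fls_vs: vector_space "\<lambda>(c::'a::field_char_0) f. fls_const c * f"
  by unfold_locales (simp_all add: algebra_simps flip: fls_plus_const)


text \<open>
  An element \<open>\<Sum>\<^sub>j P\<^sub>j(z) \<partial>\<^sup>j\<close> of the Weyl algebra is represented by its normal form, the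
  \<^typ>\<open>'a poly poly\<close> with \<open>j\<close>-th coefficient \<open>P\<^sub>j\<close>. Addition and zero are those of
  \<^typ>\<open>'a poly poly\<close>, but the product is \<open>weyl_mult\<close>, not the commutative one. It is determined
  by \<open>\<partial> \<sqdot> Q \<partial>\<^sup>j = Q \<partial>\<^sup>j\<^sup>+\<^sup>1 + Q' \<partial>\<^sup>j\<close>.
\<close>

type_synonym 'a weyl = "'a poly poly"

definition weyl_partial_mult :: "'a::field_char_0 weyl \<Rightarrow> 'a weyl" where
  "weyl_partial_mult S = pCons 0 S + map_poly pderiv S"

definition weyl_mult :: "'a::field_char_0 weyl \<Rightarrow> 'a weyl \<Rightarrow> 'a weyl" where
  "weyl_mult R S = (\<Sum>j\<le>degree R. smult (coeff R j) ((weyl_partial_mult ^^ j) S))"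

definition weyl_left_ideal :: "'a::field_char_0 weyl set \<Rightarrow> bool" where
  "weyl_left_ideal J \<longleftrightarrow>
     0 \<in> J \<and> (\<forall>R\<in>J. \<forall>S\<in>J. R + S \<in> J) \<and> (\<forall>S. \<forall>R\<in>J. weyl_mult S R \<in> J)"

definition weyl_act :: "'a::field_char_0 weyl \<Rightarrow> 'a fls \<Rightarrow> 'a fls" where
  "weyl_act R f = (\<Sum>j\<le>degree R. poly_fls (coeff R j) * (dz ^^ j) f)"

definition weyl_act_poly :: "'a::field_char_0 weyl \<Rightarrow> 'a poly \<Rightarrow> 'a poly" where
  "weyl_act_poly R A = (\<Sum>j\<le>degree R. coeff R j * (pderiv ^^ j) A)"

text \<open>
  In each summand \<open>(-1)\<^sup>j \<partial>\<^sup>j P\<^sub>j\<close> the product of \<open>\<partial>\<^sup>j\<close> and \<open>P\<^sub>j\<close> is taken in the Weyl algebra.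
\<close>

definition weyl_adjoint :: "'a::field_char_0 weyl \<Rightarrow> 'a weyl" where
  "weyl_adjoint R = (\<Sum>j\<le>degree R. smult ((-1) ^ j) (weyl_mult (monom 1 j) [:coeff R j:]))"


definition V1 :: "'a::field_char_0 weyl \<Rightarrow> 'a fls set" where
  "V1 L = {f \<in> zinv_series. weyl_act L f \<in> polys}"

text \<open>
  For nonzero \<open>L\<close> the space \<open>V1 L\<close> is finite-dimensional, so that \<open>fls_vs.dim\<close> (which is 0 on
  infinite-dimensional spaces) is its dimension without restriction.
\<close>

definition V_space :: "nat \<Rightarrow> 'a::field_char_0 weyl \<Rightarrow> 'a fls set" where
  "V_space n L = fls_vs.span {proj_inf (fls_X_inv ^ k * f) | k f. k < n \<and> f \<in> V1 L}"

definition I_ideal :: "nat \<Rightarrow> 'a::field_char_0 weyl \<Rightarrow> 'a weyl set" where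
  "I_ideal n L = {R. \<forall>f \<in> V_space n L. weyl_act R f \<in> polys}"

definition is_basis_V1 :: "'a::field_char_0 weyl \<Rightarrow> nat \<Rightarrow> (nat \<Rightarrow> 'a fls) \<Rightarrow> bool" where
  "is_basis_V1 L d f \<longleftrightarrow> inj_on f {1..d} \<and> fls_vs.independent (f ` {1..d}) \<and>
     fls_vs.span (f ` {1..d}) = V1 L"


text \<open>
  For \<open>f = \<Sum>\<^sub>k f\<^sub>k z\<^sup>-\<^sup>k\<^sup>-\<^sup>1\<close> the number \<open>f\<^sub>k\<close> is \<open>fls_nth f (k + 1)\<close>.
  In \<open>phi_ext\<close> an element of \<open>K[z][t]\<close> is an \<^typ>\<open>'a poly poly\<close> with outer variable \<open>t\<close>.
\<close>

definition phi :: "'a::field_char_0 fls \<Rightarrow> 'a poly \<Rightarrow> 'a" where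
  "phi f A = (\<Sum>k\<le>degree A. coeff A k * fls_nth f (int k + 1))"

definition phi_ext :: "'a::field_char_0 fls \<Rightarrow> 'a poly poly \<Rightarrow> 'a poly" where
  "phi_ext f B = (\<Sum>k\<le>degree B. smult (fls_nth f (int k + 1)) (coeff B k))"

text \<open>
  \<open>(P(z) - P(t)) / (z - t)\<close> in \<open>K[z][t]\<close>: the constant polynomial \<open>[:P:]\<close> is \<open>P(z)\<close>, the
  \<^const>\<open>map_poly\<close> term is \<open>P(t)\<close>, and the last factor is \<open>z - t\<close>. The division is exact.
\<close>

definition diff_quot :: "'a::field_char_0 poly \<Rightarrow> 'a poly poly" where
  "diff_quot P = ([:P:] - map_poly (\<lambda>c. [:c:]) P) div [:[:0, 1:], -1:]"

definition pade_type_approximant ::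
  "nat \<Rightarrow> nat \<Rightarrow> (nat \<Rightarrow> 'a::field_char_0 fls) \<Rightarrow> 'a poly \<Rightarrow> (nat \<Rightarrow> 'a poly) \<Rightarrow> bool" where
  "pade_type_approximant n d f P Q \<longleftrightarrow>
     (\<exists>M::nat. M \<ge> d * n \<and> degree P \<le> M \<and>
       (\<forall>j\<in>{1..d}. ord_inf (poly_fls P * f j - poly_fls (Q j)) \<ge> Fin (int n + 1)))"


lemma poly_fls_0 [simp]: "poly_fls 0 = 0"
  by (simp add: poly_fls_def)

lemma poly_fls_pCons: "poly_fls (pCons a P) = fls_const a + fls_X_inv * poly_fls P"
  by (cases "P = 0 \<and> a = 0") (auto simp: poly_fls_def map_poly_pCons)

lemma poly_fls_add: "poly_fls (P + Q) = poly_fls P + poly_fls Q"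
  by (induction P Q rule: poly_induct2)
     (simp_all add: poly_fls_pCons algebra_simps flip: fls_plus_const)

lemma poly_fls_smult: "poly_fls (smult c P) = fls_const c * poly_fls P"
  by (induction P) (simp_all add: poly_fls_pCons algebra_simps)

lemma poly_fls_mult: "poly_fls (P * Q) = poly_fls P * poly_fls Q"
  by (induction P) (simp_all add: poly_fls_pCons poly_fls_add poly_fls_smult algebra_simps)

lemma proj_inf_nth: "fls_nth (proj_inf f) k = (if k \<ge> 1 then fls_nth f k else 0)"
  by (auto simp: proj_inf_def fps_to_fls_nth)

lemma dz_add: "dz (f + g) = dz f + dz g"
  by (simp add: dz_def algebra_simps)

lemma dz_mult: "dz (f * g) = dz f * g + f * dz g"
  by (simp add: dz_def algebra_simps)

lemma dz_0 [simp]: "dz 0 = 0"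
  by (simp add: dz_def)

lemma dz_poly_fls: "dz (poly_fls P) = poly_fls (pderiv P)"
proof (induction P)
  case (pCons a P)
  have "fls_X * fls_X_inv = (1 :: 'a fls)"
    by (simp flip: fls_inverse_X)
  hence "dz fls_X_inv = (1 :: 'a fls)"
    by (simp add: dz_def flip: power_mult_distrib)
  moreover have "dz (fls_const a) = 0" by (simp add: dz_def)
  ultimately show ?case using pCons
    by (simp add: poly_fls_pCons pderiv_pCons poly_fls_add dz_add dz_mult)
qed simp

lemma weyl_act_pCons: "weyl_act (pCons P R) f = poly_fls P * f + weyl_act R (dz f)"
  by (cases "R = 0")
     (simp_all add: weyl_act_def sum.atMost_Suc_shift funpow_swap1 del: sum.atMost_Suc)

lemma weyl_act_0 [simp]: "weyl_act 0 f = 0"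
  by (simp add: weyl_act_def)

lemma weyl_act_add: "weyl_act (R + S) f = weyl_act R f + weyl_act S f"
  by (induction R S arbitrary: f rule: poly_induct2)
     (simp_all add: weyl_act_pCons poly_fls_add algebra_simps)

lemma weyl_act_smult: "weyl_act (smult P R) f = poly_fls P * weyl_act R f"
  by (induction R arbitrary: f) (simp_all add: weyl_act_pCons poly_fls_mult algebra_simps)

lemma weyl_act_partial_mult: "weyl_act (weyl_partial_mult S) f = dz (weyl_act S f)"
proof (induction S arbitrary: f)
  case (pCons P S)
  have eq: "weyl_partial_mult (pCons P S) = pCons (pderiv P) (weyl_partial_mult S + [:P:])"
    by (simp add: weyl_partial_mult_def map_poly_pCons)
  show ?case
    by (simp add: eq weyl_act_pCons weyl_act_add pCons.IH dz_add dz_mult dz_poly_fls algebra_simps)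
qed (simp add: weyl_partial_mult_def)

lemma weyl_act_mult: "weyl_act (weyl_mult R S) f = weyl_act R (weyl_act S f)"
proof -
  have "weyl_act ((weyl_partial_mult ^^ j) S) f = (dz ^^ j) (weyl_act S f)" for j
    by (induction j) (simp_all add: weyl_act_partial_mult)
  moreover have "weyl_act (\<Sum>j\<in>A. T j) f = (\<Sum>j\<in>A. weyl_act (T j) f)"
    for A and T :: "nat \<Rightarrow> 'a weyl"
    by (induction A rule: infinite_finite_induct) (simp_all add: weyl_act_add)
  ultimately show ?thesis
    by (simp add: weyl_mult_def weyl_act_def [of R] weyl_act_smult)
qed

lemma diff_quot_mult:
  "[:[:0, 1:], -1:] * diff_quot P = [:P:] - map_poly (\<lambda>c. [:c:]) P"
proof -
  have "poly (map_poly (\<lambda>c. [:c:]) P) [:0, 1:] = P"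
    by (induction P) (simp_all add: map_poly_pCons)
  hence "[:- [:0, 1:], 1:] dvd [:P:] - map_poly (\<lambda>c. [:c:]) P"
    by (subst poly_eq_0_iff_dvd [symmetric]) simp
  hence "- [:- [:0, 1:], 1:] dvd [:P:] - map_poly (\<lambda>c. [:c:]) P"
    by (simp only: minus_dvd_iff)
  hence "[:[:0, 1:], -1:] dvd [:P:] - map_poly (\<lambda>c. [:c:]) P"
    by simp
  thus ?thesis unfolding diff_quot_def by (rule dvd_mult_div_cancel)
qed

end

theory Submission
  imports Defs
begin

text \<open>
  The approximation properties rest on the residue pairing: \<open>\<phi>\<^sub>f(A)\<close> is the coefficient of \<open>1/z\<close> in \<open>A f\<close>
  (\<open>phi_eq_residue\<close>). Derivatives \<open>dg/dz\<close> have residue 0, so integration by parts makes \<open>R\<^sup>*\<close> the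
  adjoint of \<open>R\<close>: the residues of \<open>(R\<^sup>* \<cdot> A) f\<close> and of \<open>A (R \<cdot> f)\<close> agree
  (\<open>residue_weyl_adjoint\<close>). When \<open>R \<cdot> f\<close> is a polynomial, the second product is one as well and
  its residue vanishes.

  Now let \<open>R\<close> lie in \<open>I\<^sub>n(L)\<close>, let \<open>f\<close> lie in \<open>V\<^sub>1(L)\<close> and let \<open>P = R\<^sup>* \<cdot> A\<close>. For \<open>k < n\<close> the number
  \<open>\<phi>\<^sub>f(t\<^sup>k P)\<close> is the residue of \<open>P z\<^sup>k f\<close>; replacing \<open>z\<^sup>k f\<close> by \<open>\<pi>(z\<^sup>k f)\<close> changes it only by the
  residue of a polynomial, and \<open>\<pi>(z\<^sup>k f)\<close> lies in \<open>V\<^sub>n(L)\<close>, so it is 0 (\<open>phi_orthogonal\<close>). On the other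
  hand \<open>Q\<close> is exactly the polynomial part of \<open>P f\<close> (\<open>remainder_in_zinv_series\<close>), so the coefficient
  of \<open>z\<^sup>-\<^sup>k\<^sup>-\<^sup>1\<close> in \<open>P f - Q\<close> is \<open>\<phi>\<^sub>f(t\<^sup>k P)\<close> for every \<open>k \<ge> 0\<close>. This is the expansion of the
  remainder, and with the vanishing for \<open>k < n\<close> it is the order condition. The degree bound \<open>M\<close> may be
  any number that is at least \<open>deg P\<close> and \<open>d n\<close>.

  That \<open>I\<^sub>n(L)\<close> is nonzero is the Ore property of the Weyl algebra. Since \<open>V\<^sub>1(L)\<close> has finite
  dimension, \<open>V\<^sub>n(L)\<close> is spanned by finitely many series \<open>\<pi>(z\<^sup>k f)\<close>, and an operator sends such a series
  into \<open>K[z]\<close> iff it does so with \<open>z\<^sup>k f\<close>. If \<open>L \<cdot> g\<close> is a polynomial, then modulo \<open>K[z]\<close>, and up to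
  nonzero polynomial factors, every derivative of \<open>R \<cdot> g\<close> reduces to a combination of \<open>\<partial>\<^sup>k g\<close> with
  \<open>k < ord L\<close>; one derivative more than there are such \<open>k\<close> forces a linear relation, hence a nonzero
  \<open>S\<close> with \<open>S \<cdot> (R \<cdot> g)\<close> polynomial (\<open>annihilator_of_weyl_act\<close>). Composing such operators, one for
  each generator, gives a common one for all of them (\<open>common_annihilator\<close>); the composite is nonzero
  because the Weyl algebra has no zero divisors (\<open>weyl_mult_nonzero\<close>).
\<close>

section \<open>Linear dependence over an integral domain\<close>

text \<open>
  Gaussian elimination without division: a row with a nonzero entry in column \<open>j\<close> serves as pivot,
  and cross-multiplying with it clears that column in all other rows.
\<close>

lemma finite_linear_dependence_idom:
  fixes a :: "'i \<Rightarrow> 'j \<Rightarrow> 'b::idom"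
  assumes "finite J" "finite I" "card J < card I"
  shows "\<exists>c. (\<exists>i\<in>I. c i \<noteq> 0) \<and> (\<forall>j\<in>J. (\<Sum>i\<in>I. c i * a i j) = 0)"
  using assms
proof (induction J arbitrary: I a rule: finite_induct)
  case empty
  then obtain i where "i \<in> I" by fastforce
  thus ?case by (intro exI [of _ "\<lambda>_. 1"]) auto
next
  case (insert j J)
  show ?case
  proof (cases "\<forall>i\<in>I. a i j = 0")
    case True
    have "card J < card I" using insert by simp
    then obtain c where "\<exists>i\<in>I. c i \<noteq> 0" "\<forall>j\<in>J. (\<Sum>i\<in>I. c i * a i j) = 0"
      using insert.IH insert.prems(1) by blast
    thus ?thesis using True by (intro exI [of _ c]) auto
  next
    case False
    then obtain p where p: "p \<in> I" "a p j \<noteq> 0" by blast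
    define b where "b i k = a p j * a i k - a i j * a p k" for i k
    have "card J < card (I - {p})" using insert p by simp
    then obtain c where c: "\<exists>i\<in>I-{p}. c i \<noteq> 0" "\<forall>k\<in>J. (\<Sum>i\<in>I-{p}. c i * b i k) = 0"
      using insert.IH [of "I - {p}" b] insert.prems(1) by blast
    \<comment> \<open>\<open>c'\<close> is the relation \<open>c\<close> between the cleared rows \<open>b\<close>, written in terms of the rows of \<open>a\<close>.\<close>
    define c' where "c' i = (if i = p then - (\<Sum>i\<in>I-{p}. c i * a i j) else a p j * c i)" for i
    have "(\<Sum>i\<in>I. c' i * a i k) = (\<Sum>i\<in>I-{p}. c i * b i k)" for k
    proof -
      have "(\<Sum>i\<in>I. c' i * a i k) = c' p * a p k + (\<Sum>i\<in>I-{p}. c' i * a i k)"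
        using insert.prems(1) p(1) by (rule sum.remove)
      also have "(\<Sum>i\<in>I-{p}. c' i * a i k) = (\<Sum>i\<in>I-{p}. a p j * c i * a i k)"
        by (intro sum.cong) (auto simp: c'_def)
      finally show ?thesis
        by (simp add: c'_def b_def sum_distrib_right sum_distrib_left sum_subtractf algebra_simps)
    qed
    moreover have "b i j = 0" for i by (simp add: b_def)
    moreover have "\<exists>i\<in>I. c' i \<noteq> 0" using c(1) p(2) by (auto simp: c'_def)
    ultimately show ?thesis using c(2) by (intro exI [of _ c']) auto
  qed
qed

section \<open>The Weyl algebra and its action\<close>

lemma poly_fls_1 [simp]: "poly_fls 1 = 1"
  by (simp add: one_pCons poly_fls_pCons)

lemma poly_fls_monom: "poly_fls (monom c k) = fls_const c * fls_X_inv ^ k"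
  by (induction k) (simp_all add: monom_0 monom_Suc poly_fls_pCons mult_ac)

lemma weyl_act_sum_left: "weyl_act (\<Sum>j\<in>A. T j) f = (\<Sum>j\<in>A. weyl_act (T j) f)"
  by (induction A rule: infinite_finite_induct) (simp_all add: weyl_act_add)

lemma weyl_act_monom: "weyl_act (monom p j) f = poly_fls p * (dz ^^ j) f"
  by (induction j arbitrary: f)
     (simp_all add: monom_0 monom_Suc weyl_act_pCons funpow_swap1 del: funpow.simps,
      simp add: funpow_Suc_right del: funpow.simps)

lemma weyl_act_add_right: "weyl_act R (f + g) = weyl_act R f + weyl_act R g"
  by (induction R arbitrary: f g) (simp_all add: weyl_act_pCons dz_add algebra_simps)

lemma weyl_act_const_right: "weyl_act R (fls_const c * f) = fls_const c * weyl_act R f"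
proof -
  have "dz (fls_const c * f) = fls_const c * dz f" for f by (simp add: dz_def)
  thus ?thesis
    by (induction R arbitrary: f) (simp_all add: weyl_act_pCons algebra_simps)
qed

lemma weyl_act_zero_right [simp]: "weyl_act R 0 = 0"
  by (induction R) (simp_all add: weyl_act_pCons)

lemma poly_fls_weyl_act_poly: "poly_fls (weyl_act_poly R A) = weyl_act R (poly_fls A)"
proof -
  have "(dz ^^ j) (poly_fls A) = poly_fls ((pderiv ^^ j) A)" for j
    by (induction j) (simp_all add: dz_poly_fls)
  moreover have "poly_fls (\<Sum>j\<in>I. B j) = (\<Sum>j\<in>I. poly_fls (B j))" for I and B :: "nat \<Rightarrow> 'a poly"
    by (induction I rule: infinite_finite_induct) (simp_all add: poly_fls_add)
  ultimately show ?thesis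
    by (simp add: weyl_act_poly_def weyl_act_def poly_fls_mult)
qed

lemma polys_0 [simp]: "0 \<in> polys"
  by (metis poly_fls_0 rangeI)

lemma polys_add: "f \<in> polys \<Longrightarrow> g \<in> polys \<Longrightarrow> f + g \<in> polys"
  by (auto simp flip: poly_fls_add)

lemma polys_mult_poly_fls: "f \<in> polys \<Longrightarrow> poly_fls P * f \<in> polys"
  by (auto simp flip: poly_fls_mult)

lemma polys_mult_const: "f \<in> polys \<Longrightarrow> fls_const c * f \<in> polys"
  by (auto simp flip: poly_fls_smult)

lemma polys_diff: "f \<in> polys \<Longrightarrow> g \<in> polys \<Longrightarrow> f - g \<in> polys"
  using polys_add [of f "fls_const (-1) * g"] polys_mult_const [of g "-1"] by simp

lemma polys_sum: "(\<And>j. j \<in> A \<Longrightarrow> T j \<in> polys) \<Longrightarrow> (\<Sum>j\<in>A. T j) \<in> polys"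
  by (induction A rule: infinite_finite_induct) (simp_all add: polys_add)

lemma polys_dz: "f \<in> polys \<Longrightarrow> dz f \<in> polys"
  by (auto simp: dz_poly_fls)

lemma polys_weyl_act: "f \<in> polys \<Longrightarrow> weyl_act R f \<in> polys"
  by (auto simp flip: poly_fls_weyl_act_poly)

lemma degree_lead_coeff_partial_mult:
  assumes "S \<noteq> 0"
  shows "degree (weyl_partial_mult S) = Suc (degree S)"
    "lead_coeff (weyl_partial_mult S) = lead_coeff S"
proof -
  have "degree (map_poly pderiv S) \<le> degree S" by (rule map_poly_degree_leq)
  moreover have "degree (pCons 0 S) = Suc (degree S)" using assms by simp
  ultimately show *: "degree (weyl_partial_mult S) = Suc (degree S)"
    unfolding weyl_partial_mult_def by (subst degree_add_eq_left) auto
  have "coeff (map_poly pderiv S) (Suc (degree S)) = 0"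
    by (simp add: coeff_map_poly coeff_eq_0)
  thus "lead_coeff (weyl_partial_mult S) = lead_coeff S"
    unfolding * by (simp add: weyl_partial_mult_def)
qed

lemma degree_lead_coeff_partial_mult_funpow:
  assumes "S \<noteq> 0"
  shows "degree ((weyl_partial_mult ^^ j) S) = degree S + j \<and>
    lead_coeff ((weyl_partial_mult ^^ j) S) = lead_coeff S"
proof (induction j)
  case (Suc j)
  have "(weyl_partial_mult ^^ j) S \<noteq> 0" using Suc assms by (metis leading_coeff_0_iff)
  from degree_lead_coeff_partial_mult [OF this] Suc show ?case by (simp, metis)
qed simp

text \<open>
  Leading coefficients multiply: every monomial \<open>\<partial>\<^sup>j\<close> of \<open>R\<close> raises the order of \<open>S\<close> by exactly
  \<open>j\<close> and keeps its leading coefficient, so only the top one reaches order \<open>ord R + ord S\<close>.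
\<close>

lemma weyl_mult_nonzero:
  assumes "R \<noteq> 0" "S \<noteq> 0"
  shows "weyl_mult R S \<noteq> 0"
proof -
  let ?D = "\<lambda>j. (weyl_partial_mult ^^ j) S"
  have "coeff (weyl_mult R S) (degree S + degree R) =
      (\<Sum>j\<le>degree R. coeff R j * coeff (?D j) (degree S + degree R))"
    by (simp add: weyl_mult_def coeff_sum)
  also have "\<dots> = (\<Sum>j\<in>{degree R}. coeff R j * coeff (?D j) (degree S + degree R))"
  proof (intro sum.mono_neutral_right ballI)
    fix j assume "j \<in> {..degree R} - {degree R}"
    hence "degree (?D j) < degree S + degree R"
      using degree_lead_coeff_partial_mult_funpow [OF assms(2), of j] by auto
    thus "coeff R j * coeff (?D j) (degree S + degree R) = 0" by (simp add: coeff_eq_0)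
  qed auto
  also have "\<dots> = lead_coeff R * lead_coeff S"
    using degree_lead_coeff_partial_mult_funpow [OF assms(2), of "degree R"] by (simp, metis)
  finally show ?thesis using assms by auto
qed

section \<open>Ore condition and common annihilators modulo polynomials\<close>

text \<open>
  Pseudo-division by \<open>L\<close>: multiplying by powers of the leading coefficient of \<open>L\<close> avoids fractions.
  The quotient part acts on \<open>g\<close> through \<open>L \<cdot> g\<close> and so contributes only polynomials, which is why
  only the remainder \<open>T\<close> is recorded.
\<close>

lemma pseudo_remainder_mod_polys:
  fixes L :: "'a::field_char_0 weyl"
  assumes "L \<noteq> 0" "weyl_act L g \<in> polys"
  shows "\<exists>p T. p \<noteq> 0 \<and> (\<forall>k\<ge>degree L. coeff T k = 0) \<and>
    poly_fls p * weyl_act R g - weyl_act T g \<in> polys"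
proof -
  have "\<exists>p T. p \<noteq> 0 \<and> (\<forall>k\<ge>degree L. coeff T k = 0) \<and>
    poly_fls p * weyl_act R g - weyl_act T g \<in> polys" if "\<forall>k\<ge>N. coeff R k = 0" for N R
    using that
  proof (induction N arbitrary: R)
    case 0
    hence "R = 0" by (simp add: poly_eq_iff)
    thus ?case by (intro exI [of _ 1] exI [of _ 0]) simp
  next
    case (Suc N)
    show ?case
    proof (cases "N < degree L")
      case True
      have "poly_fls 1 * weyl_act R g - weyl_act R g \<in> polys" by simp
      moreover have "\<forall>k\<ge>degree L. coeff R k = 0" using Suc.prems True by auto
      ultimately show ?thesis by (metis one_neq_zero)
    next
      case False
      \<comment> \<open>\<open>D\<close> is \<open>\<partial>\<^sup>N\<^sup>-\<^sup>r L\<close> with \<open>r = ord L\<close>: it has order \<open>N\<close> and the leading coefficient of \<open>L\<close>.\<close>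
      define D where "D = (weyl_partial_mult ^^ (N - degree L)) L"
      have D: "degree D = N" "coeff D N = lead_coeff L"
        using degree_lead_coeff_partial_mult_funpow [OF assms(1), of "N - degree L"] False
        by (auto simp: D_def)
      have "weyl_act ((weyl_partial_mult ^^ k) L) g \<in> polys" for k
        using assms(2) by (induction k) (simp_all add: weyl_act_partial_mult polys_dz)
      hence Dg: "weyl_act D g \<in> polys" by (simp only: D_def)
      define R' where "R' = smult (lead_coeff L) R - smult (coeff R N) D"
      have "\<forall>k\<ge>N. coeff R' k = 0"
      proof (intro allI impI)
        fix k assume "N \<le> k"
        thus "coeff R' k = 0"
          using D Suc.prems by (cases "k = N") (auto simp: R'_def coeff_eq_0)
      qed
      from Suc.IH [OF this] obtain p T where pT: "p \<noteq> 0" "\<forall>k\<ge>degree L. coeff T k = 0"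
          "poly_fls p * weyl_act R' g - weyl_act T g \<in> polys" by blast
      have "smult (lead_coeff L) R = R' + smult (coeff R N) D" by (simp add: R'_def)
      hence "poly_fls (lead_coeff L) * weyl_act R g =
          weyl_act R' g + poly_fls (coeff R N) * weyl_act D g"
        by (metis weyl_act_add weyl_act_smult)
      hence "poly_fls (p * lead_coeff L) * weyl_act R g - weyl_act T g =
          (poly_fls p * weyl_act R' g - weyl_act T g)
          + poly_fls (p * coeff R N) * weyl_act D g"
        by (simp add: poly_fls_mult algebra_simps)
      hence "poly_fls (p * lead_coeff L) * weyl_act R g - weyl_act T g \<in> polys"
        using pT(3) Dg by (simp only: polys_add polys_mult_poly_fls)
      moreover have "p * lead_coeff L \<noteq> 0" using pT(1) assms(1) by simp
      ultimately show ?thesis using pT(2) by blast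
    qed
  qed
  from this [of "Suc (degree R)" R] show ?thesis by (simp add: coeff_eq_0)
qed

text \<open>
  With \<open>r = ord L\<close>, each of the \<open>r + 1\<close> operators \<open>\<partial>\<^sup>j R\<close>, \<open>j \<le> r\<close>, has a pseudo-remainder with at most
  \<open>r\<close> coefficients. A relation between the remainders combines the \<open>\<partial>\<^sup>j R\<close> to an operator that maps
  \<open>g\<close> into \<open>K[z]\<close>.
\<close>

lemma annihilator_of_weyl_act:
  assumes "L \<noteq> 0" "weyl_act L g \<in> polys"
  shows "\<exists>S. S \<noteq> 0 \<and> weyl_act S (weyl_act R g) \<in> polys"
proof -
  let ?r = "degree L"
  have "\<forall>j. \<exists>p T. p \<noteq> 0 \<and> (\<forall>k\<ge>?r. coeff T k = 0) \<and>
      poly_fls p * weyl_act (weyl_mult (monom 1 j) R) g - weyl_act T g \<in> polys"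
    using pseudo_remainder_mod_polys [OF assms] by blast
  then obtain p T where p: "\<And>j. p j \<noteq> 0" and T: "\<And>j k. k \<ge> ?r \<Longrightarrow> coeff (T j) k = 0"
    and "\<And>j. poly_fls (p j) * weyl_act (weyl_mult (monom 1 j) R) g - weyl_act (T j) g \<in> polys"
    by metis
  hence pT: "poly_fls (p j) * (dz ^^ j) (weyl_act R g) - weyl_act (T j) g \<in> polys" for j
    by (simp add: weyl_act_mult weyl_act_monom)
  obtain c where c: "\<exists>j\<in>{..?r}. c j \<noteq> 0"
      "\<forall>k\<in>{..<?r}. (\<Sum>j\<in>{..?r}. c j * coeff (T j) k) = 0"
    using finite_linear_dependence_idom [of "{..<?r}" "{..?r}" "\<lambda>j k. coeff (T j) k"] by auto
  define S where "S = (\<Sum>j\<le>?r. monom (c j * p j) j)"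
  have "coeff S j = c j * p j" if "j \<le> ?r" for j
    using that by (simp add: S_def coeff_sum)
  hence "S \<noteq> 0" using c(1) p by fastforce
  have "(\<Sum>j\<le>?r. smult (c j) (T j)) = 0"
  proof (rule poly_eqI)
    fix k show "coeff (\<Sum>j\<le>?r. smult (c j) (T j)) k = coeff 0 k"
      using c(2) T by (cases "k < ?r") (simp_all add: coeff_sum)
  qed
  hence "(\<Sum>j\<le>?r. poly_fls (c j) * weyl_act (T j) g) = 0"
    by (metis (no_types, lifting) sum.cong weyl_act_0 weyl_act_smult weyl_act_sum_left)
  hence "weyl_act S (weyl_act R g) =
      (\<Sum>j\<le>?r. poly_fls (c j) * (poly_fls (p j) * (dz ^^ j) (weyl_act R g) - weyl_act (T j) g))"
    by (simp add: S_def weyl_act_sum_left weyl_act_monom poly_fls_mult right_diff_distrib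
        sum_subtractf mult.assoc)
  also have "\<dots> \<in> polys" by (intro polys_sum polys_mult_poly_fls pT)
  finally show ?thesis using \<open>S \<noteq> 0\<close> by blast
qed

text \<open>
  Composition takes the place of a least common left multiple: once \<open>R\<close> serves the elements treated so
  far, any \<open>S R\<close> still does, since operators preserve \<open>K[z]\<close>, and \<open>S\<close> is chosen for \<open>R \<cdot> h\<close>.
\<close>

lemma common_annihilator:
  assumes "finite H" "\<And>h. h \<in> H \<Longrightarrow> \<exists>L. L \<noteq> 0 \<and> weyl_act L h \<in> polys"
  shows "\<exists>R. R \<noteq> 0 \<and> (\<forall>h\<in>H. weyl_act R h \<in> polys)"
  using assms
proof (induction H rule: finite_induct)
  case empty
  thus ?case by (intro exI [of _ 1]) simp
next
  case (insert h H)
  then obtain R where R: "R \<noteq> 0" "\<forall>h\<in>H. weyl_act R h \<in> polys" by blast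
  obtain L where L: "L \<noteq> 0" "weyl_act L h \<in> polys"
    using insert.prems [OF insertI1] by (elim exE conjE)
  obtain S where S: "S \<noteq> 0" "weyl_act S (weyl_act R h) \<in> polys"
    using annihilator_of_weyl_act [OF L, of R] by (elim exE conjE)
  have "weyl_act S (weyl_act R x) \<in> polys" if "x \<in> H" for x
    by (rule polys_weyl_act) (rule bspec [OF R(2) that])
  with S(2) have "\<forall>x\<in>insert h H. weyl_act (weyl_mult S R) x \<in> polys"
    unfolding weyl_act_mult by (metis insert_iff)
  with weyl_mult_nonzero [OF S(1) R(1)] show ?case by (intro exI conjI)
qed

section \<open>Coefficients of products and the projection at infinity\<close>

lemma poly_fls_eq_sum: "poly_fls A = (\<Sum>k\<le>degree A. fls_const (coeff A k) * fls_X_inv ^ k)"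
  by (cases "A = 0") (simp_all add: poly_fls_def poly_altdef coeff_map_poly degree_map_poly)

lemma fls_nth_poly_fls_mult:
  "fls_nth (poly_fls A * f) m = (\<Sum>k\<le>degree A. coeff A k * fls_nth f (m + int k))"
  by (simp add: poly_fls_eq_sum sum_distrib_right fls_nth_sum mult.assoc
      fls_X_inv_power_times_conv_shift(1))

lemma fls_nth_poly_fls_pos: "m > 0 \<Longrightarrow> fls_nth (poly_fls A) m = 0"
  using fls_nth_poly_fls_mult [of A 1 m] by simp

lemma phi_eq_residue: "phi f A = fls_nth (poly_fls A * f) 1"
  by (simp add: phi_def fls_nth_poly_fls_mult add.commute)

text \<open>
  The derivative of \<open>z\<^sup>-\<^sup>m\<close> is \<open>-m z\<^sup>-\<^sup>m\<^sup>-\<^sup>1\<close>, and for \<open>m = 0\<close> the factor kills the would-be residue.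
\<close>

lemma dz_nth_1: "fls_nth (dz f) 1 = 0"
  by (simp add: dz_def fls_X_power_times_conv_shift)

lemma poly_fls_nonpos_part: "(\<Sum>k\<le>N. fls_const (fls_nth f (- int k)) * fls_X_inv ^ k) \<in> polys"
  by (intro polys_sum) (simp flip: poly_fls_monom)

text \<open>
  A Laurent series in \<open>1/z\<close> has only finitely many terms with a nonnegative power of \<open>z\<close>.
\<close>

lemma diff_proj_inf_in_polys: "f - proj_inf f \<in> polys"
proof -
  define N where "N = nat (- fls_subdegree f)"
  have "f - proj_inf f = (\<Sum>k\<le>N. fls_const (fls_nth f (- int k)) * fls_X_inv ^ k)"
  proof (rule fls_eqI)
    fix m
    have "(\<Sum>k\<le>N. fls_nth f (- int k) * (if m = - int k then 1 else 0)) =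
        (\<Sum>k\<le>N. if k = nat (- m) then (if m \<le> 0 then fls_nth f m else 0) else 0)"
      by (intro sum.cong) auto
    also have "\<dots> = (if m \<le> 0 then fls_nth f m else 0)"
      by (auto simp: N_def intro!: fls_eq0_below_subdegree [symmetric])
    finally show "fls_nth (f - proj_inf f) m =
        fls_nth (\<Sum>k\<le>N. fls_const (fls_nth f (- int k)) * fls_X_inv ^ k) m"
      by (simp add: proj_inf_nth fls_nth_sum)
  qed
  thus ?thesis using poly_fls_nonpos_part by simp
qed

lemma weyl_act_proj_inf_in_polys_iff:
  "weyl_act R (proj_inf f) \<in> polys \<longleftrightarrow> weyl_act R f \<in> polys"
proof -
  have "weyl_act R f = weyl_act R (proj_inf f) + weyl_act R (f - proj_inf f)"
    by (simp flip: weyl_act_add_right)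
  moreover have "weyl_act R (f - proj_inf f) \<in> polys"
    by (intro polys_weyl_act diff_proj_inf_in_polys)
  ultimately show ?thesis
    by (metis polys_add polys_diff add_diff_cancel_right')
qed

lemma fls_nth_poly_fls_mult_proj_inf:
  "fls_nth (poly_fls A * proj_inf f) 1 = fls_nth (poly_fls A * f) 1"
  by (simp add: fls_nth_poly_fls_mult proj_inf_nth)

section \<open>The annihilating left ideal\<close>

lemma weyl_left_ideal_I_ideal: "weyl_left_ideal (I_ideal n L)"
  by (simp add: weyl_left_ideal_def I_ideal_def weyl_act_add weyl_act_mult polys_add
      polys_weyl_act)

lemma subspace_weyl_act_in_polys: "fls_vs.subspace {g. weyl_act R g \<in> polys}"
proof (intro fls_vs.subspaceI; unfold mem_Collect_eq)
  show "weyl_act R 0 \<in> polys" by (simp only: weyl_act_zero_right polys_0)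
  show "weyl_act R (f + g) \<in> polys" if "weyl_act R f \<in> polys" "weyl_act R g \<in> polys" for f g
    unfolding weyl_act_add_right using that by (rule polys_add)
  show "weyl_act R (fls_const c * g) \<in> polys" if "weyl_act R g \<in> polys" for c g
    unfolding weyl_act_const_right using that by (rule polys_mult_const)
qed

text \<open>
  Multiplication by \<open>z\<^sup>k\<close> is itself a differential operator. This transports both the existence of
  annihilators and the closure under linear combinations from \<open>f\<close> to \<open>z\<^sup>k f\<close>.
\<close>

lemma weyl_act_X_inv_power:
  "weyl_act R (fls_X_inv ^ k * f) = weyl_act (weyl_mult R [:monom 1 k:]) f"
  by (simp add: weyl_act_mult weyl_act_pCons poly_fls_monom)

text \<open>
  Positive dimension is used to obtain a finite basis: \<open>fls_vs.dim\<close> is 0 on infinite-dimensional spaces.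
\<close>

lemma I_ideal_nonzero:
  assumes "L \<noteq> 0" "fls_vs.dim (V1 L) > 0"
  shows "I_ideal n L \<noteq> {0}"
proof -
  obtain B where B: "B \<subseteq> V1 L" "V1 L \<subseteq> fls_vs.span B" "card B = fls_vs.dim (V1 L)"
    using fls_vs.basis_exists [of "V1 L"] by metis
  have "finite B" using B(3) assms(2) by (metis card.infinite less_irrefl)
  define H where "H = (\<lambda>(k, f). proj_inf (fls_X_inv ^ k * f)) ` ({..<n} \<times> B)"
  have "\<exists>R. R \<noteq> 0 \<and> (\<forall>h\<in>H. weyl_act R h \<in> polys)"
  proof (rule common_annihilator)
    show "finite H" using \<open>finite B\<close> by (simp add: H_def)
    fix h assume "h \<in> H"
    then obtain k f where h: "h = proj_inf (fls_X_inv ^ k * f)" "f \<in> B" by (auto simp: H_def)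
    hence "weyl_act L f \<in> polys" using B(1) by (auto simp: V1_def)
    from annihilator_of_weyl_act [OF assms(1) this, of "[:monom 1 k:]"]
    show "\<exists>S. S \<noteq> 0 \<and> weyl_act S h \<in> polys"
      unfolding h(1) weyl_act_proj_inf_in_polys_iff weyl_act_X_inv_power weyl_act_mult .
  qed
  then obtain R where R: "R \<noteq> 0" "\<And>h. h \<in> H \<Longrightarrow> weyl_act R h \<in> polys" by blast
  have gen: "weyl_act R (proj_inf (fls_X_inv ^ k * f)) \<in> polys" if "k < n" "f \<in> V1 L" for k f
  proof -
    let ?R = "weyl_mult R [:monom 1 k:]"
    have iff: "weyl_act R (proj_inf (fls_X_inv ^ k * g)) \<in> polys \<longleftrightarrow> weyl_act ?R g \<in> polys" for g
      unfolding weyl_act_proj_inf_in_polys_iff weyl_act_X_inv_power ..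
    have "B \<subseteq> {g. weyl_act ?R g \<in> polys}"
    proof
      fix g assume "g \<in> B"
      hence "proj_inf (fls_X_inv ^ k * g) \<in> H" using that(1) by (auto simp: H_def)
      from R(2) [OF this] show "g \<in> {g. weyl_act ?R g \<in> polys}"
        unfolding iff mem_Collect_eq .
    qed
    hence "fls_vs.span B \<subseteq> {g. weyl_act ?R g \<in> polys}"
      using subspace_weyl_act_in_polys by (rule fls_vs.span_minimal)
    thus ?thesis unfolding iff using B(2) that(2) by (metis (no_types, lifting) mem_Collect_eq subsetD)
  qed
  have "V_space n L \<subseteq> {g. weyl_act R g \<in> polys}"
    unfolding V_space_def using subspace_weyl_act_in_polys
    by (rule fls_vs.span_minimal [rotated]) (use gen in \<open>clarify, metis\<close>)
  hence "R \<in> I_ideal n L"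
    by (simp only: I_ideal_def subset_eq mem_Collect_eq)
  thus ?thesis using R(1) by blast
qed

section \<open>The formal adjoint as adjoint for the residue pairing\<close>

lemma residue_dz_mult: "fls_nth (dz f * g) 1 = - fls_nth (f * dz g) 1"
proof -
  have "fls_nth (dz f * g) 1 + fls_nth (f * dz g) 1 = fls_nth (dz (f * g)) 1"
    by (simp only: dz_mult fls_plus_nth)
  thus ?thesis by (simp only: dz_nth_1 add_eq_0_iff2)
qed

lemma residue_dz_funpow_mult:
  "fls_nth ((dz ^^ j) f * g) 1 = (- 1) ^ j * fls_nth (f * (dz ^^ j) g) 1"
proof (induction j arbitrary: g)
  case (Suc j)
  show ?case
    using Suc.IH [of "dz g"] by (simp add: residue_dz_mult funpow_swap1 [of dz j g])
qed simp

text \<open>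
  The sign \<open>(-1)\<^sup>j\<close> in the adjoint cancels the sign of \<open>j\<close> integrations by parts.
\<close>

lemma residue_weyl_adjoint:
  fixes R :: "'a::field_char_0 weyl"
  shows "fls_nth (weyl_act (weyl_adjoint R) g * f) 1 = fls_nth (g * weyl_act R f) 1"
proof -
  have sgn: "poly_fls ((- 1) ^ j) = (fls_const ((- 1) ^ j) :: 'a fls)" for j
  proof -
    have "((- 1) ^ j :: 'a poly) = [:(- 1) ^ j:]"
      by (simp add: one_pCons poly_const_pow)
    hence "poly_fls ((- 1) ^ j) = poly_fls [:(- 1 :: 'a) ^ j:]" by (rule arg_cong)
    thus ?thesis by (simp only: poly_fls_pCons poly_fls_0 mult_zero_right add_0_right)
  qed
  have "weyl_act (weyl_adjoint R) g * f =
     (\<Sum>j\<le>degree R. fls_const ((- 1) ^ j) * ((dz ^^ j) (poly_fls (coeff R j) * g) * f))"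
    by (simp add: weyl_adjoint_def weyl_act_sum_left weyl_act_smult weyl_act_mult weyl_act_monom
       weyl_act_pCons sgn sum_distrib_right mult.assoc)
  hence "fls_nth (weyl_act (weyl_adjoint R) g * f) 1 =
     (\<Sum>j\<le>degree R. (- 1) ^ j * fls_nth ((dz ^^ j) (poly_fls (coeff R j) * g) * f) 1)"
    by (simp add: fls_nth_sum)
  also have "\<dots> = (\<Sum>j\<le>degree R. fls_nth (g * (poly_fls (coeff R j) * (dz ^^ j) f)) 1)"
  proof (rule sum.cong [OF refl])
    fix j
    have "(- 1 :: 'a) ^ j * ((- 1) ^ j * x) = x" for x by (cases "even j") simp_all
    moreover have "poly_fls (coeff R j) * g * (dz ^^ j) f = g * (poly_fls (coeff R j) * (dz ^^ j) f)"
      by (simp only: mult_ac)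
    ultimately show "(- 1) ^ j * fls_nth ((dz ^^ j) (poly_fls (coeff R j) * g) * f) 1 =
        fls_nth (g * (poly_fls (coeff R j) * (dz ^^ j) f)) 1"
      by (simp only: residue_dz_funpow_mult)
  qed
  also have "\<dots> = fls_nth (g * weyl_act R f) 1"
    by (simp add: weyl_act_def sum_distrib_left fls_nth_sum)
  finally show ?thesis .
qed

section \<open>The numerators and the remainders\<close>

text \<open>
  For \<open>a + z P\<close> the quotient is \<open>(z P(z) - t P(t)) / (z - t) = P(z) + t (P(z) - P(t)) / (z - t)\<close>.
\<close>

lemma diff_quot_pCons: "diff_quot (pCons a P) = pCons P (diff_quot P)"
proof -
  let ?zt = "[:[:0, 1:], -1:] :: 'a poly poly"
  have "?zt * pCons P (diff_quot P) = pCons 0 (?zt * diff_quot P) + smult P ?zt"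
    by simp
  also have "\<dots> = [:pCons a P:] - map_poly (\<lambda>c. [:c:]) (pCons a P)"
    by (simp only: diff_quot_mult) (simp add: map_poly_pCons)
  also have "\<dots> = ?zt * diff_quot (pCons a P)"
    by (rule diff_quot_mult [symmetric])
  finally show ?thesis
    by (metis mult_left_cancel pCons_eq_0_iff one_neq_zero neg_equal_0_iff_equal)
qed

lemma phi_ext_eq_sum:
  assumes "degree B \<le> N"
  shows "phi_ext f B = (\<Sum>k\<le>N. smult (fls_nth f (int k + 1)) (coeff B k))"
  unfolding phi_ext_def using assms
  by (intro sum.mono_neutral_left) (auto simp: coeff_eq_0)

text \<open>
  Multiplication by \<open>t\<close> under \<open>\<phi>\<^sub>f\<close> shifts the coefficients of \<open>f\<close>, that is, replaces \<open>f\<close> by \<open>\<pi>(z f)\<close>.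
\<close>

lemma phi_ext_pCons:
  "phi_ext f (pCons p B) = smult (fls_nth f 1) p + phi_ext (proj_inf (fls_X_inv * f)) B"
proof -
  have "degree (pCons p B) \<le> Suc (degree B)" by (rule degree_pCons_le)
  from phi_ext_eq_sum [OF this] show ?thesis
    by (simp add: phi_ext_def sum.atMost_Suc_shift proj_inf_nth fls_X_inv_times_conv_shift
        algebra_simps del: sum.atMost_Suc)
qed

text \<open>
  Adding a constant to \<open>P\<close> does not move the product out of \<open>1/z K[[1/z]]\<close>. For a factor \<open>z\<close>, split
  \<open>z f = f\<^sub>0 + \<pi>(z f)\<close>: the part \<open>f\<^sub>0 P\<close> is the new summand of the numerator, and the induction
  hypothesis applies to \<open>P\<close> and \<open>\<pi>(z f)\<close>.
\<close>

lemma remainder_in_zinv_series: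
  assumes "f \<in> zinv_series"
  shows "poly_fls P * f - poly_fls (phi_ext f (diff_quot P)) \<in> zinv_series"
  using assms
proof (induction P arbitrary: f)
  case 0
  thus ?case by (simp add: diff_quot_def phi_ext_def zinv_series_def)
next
  case (pCons a P)
  define g where "g = proj_inf (fls_X_inv * f)"
  have g_zinv: "g \<in> zinv_series" by (simp add: g_def zinv_series_def proj_inf_nth)
  have split: "fls_X_inv * f = fls_const (fls_nth f 1) + g"
  proof (rule fls_eqI)
    fix n show "fls_nth (fls_X_inv * f) n = fls_nth (fls_const (fls_nth f 1) + g) n"
      using pCons.prems
      by (cases n "0::int" rule: linorder_cases)
         (auto simp: g_def proj_inf_nth zinv_series_def fls_X_inv_times_conv_shift)
  qed
  have "poly_fls (pCons a P) * f = fls_const a * f + poly_fls P * (fls_X_inv * f)"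
    by (simp add: poly_fls_pCons algebra_simps)
  also have "\<dots> = fls_const a * f + fls_const (fls_nth f 1) * poly_fls P + poly_fls P * g"
    unfolding split by (simp add: algebra_simps)
  finally have "poly_fls (pCons a P) * f - poly_fls (phi_ext f (diff_quot (pCons a P))) =
      fls_const a * f + (poly_fls P * g - poly_fls (phi_ext g (diff_quot P)))"
    by (simp add: diff_quot_pCons phi_ext_pCons poly_fls_add poly_fls_smult flip: g_def)
  thus ?case using pCons.IH [OF g_zinv] pCons.prems by (simp add: zinv_series_def)
qed

lemma fls_nth_remainder:
  "fls_nth (poly_fls P * f - poly_fls (phi_ext f (diff_quot P))) (int k + 1) =
    phi f (monom 1 k * P)"
proof -
  have "poly_fls (monom 1 k * P) * f = fls_X_inv ^ k * (poly_fls P * f)"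
    by (simp add: poly_fls_mult poly_fls_monom mult.assoc)
  hence "phi f (monom 1 k * P) = fls_nth (poly_fls P * f) (int k + 1)"
    by (simp add: phi_eq_residue fls_X_inv_power_times_conv_shift add.commute)
  thus ?thesis by (simp add: fls_nth_poly_fls_pos)
qed

text \<open>
  The adjoint turns the pairing of \<open>\<pi>(z\<^sup>k f)\<close> with \<open>R\<^sup>* \<cdot> A\<close> into the residue of a polynomial.
\<close>

lemma phi_orthogonal:
  assumes "f \<in> V1 L" "R \<in> I_ideal n L" "k < n"
  shows "phi f (monom 1 k * weyl_act_poly (weyl_adjoint R) A) = 0"
proof -
  let ?P = "weyl_act_poly (weyl_adjoint R) A" and ?h = "proj_inf (fls_X_inv ^ k * f)"
  have "?h \<in> V_space n L"
    unfolding V_space_def using assms(1,3) by (intro fls_vs.span_base) blast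
  then obtain B where B: "weyl_act R ?h = poly_fls B"
    using assms(2) by (auto simp: I_ideal_def)
  have "phi f (monom 1 k * ?P) = fls_nth (poly_fls ?P * (fls_X_inv ^ k * f)) 1"
    by (simp add: phi_eq_residue poly_fls_mult poly_fls_monom mult_ac)
  also have "\<dots> = fls_nth (poly_fls ?P * ?h) 1"
    by (simp add: fls_nth_poly_fls_mult_proj_inf)
  also have "\<dots> = fls_nth (poly_fls A * weyl_act R ?h) 1"
    by (simp add: poly_fls_weyl_act_poly residue_weyl_adjoint)
  also have "\<dots> = fls_nth (poly_fls (A * B)) 1"
    by (simp add: B poly_fls_mult)
  finally show ?thesis by (simp add: fls_nth_poly_fls_pos)
qed

section \<open>Convergence of Laurent expansions\<close>

text \<open>
  The distance of two distinct series is \<open>2\<^sup>-\<^sup>m\<close> with \<open>m\<close> the least index where they differ, so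
  agreement up to index \<open>N\<close> bounds it by \<open>2\<^sup>-\<^sup>N\<close>.
\<close>

lemma LIMSEQ_fls_I:
  fixes S :: "nat \<Rightarrow> 'a::group_add fls"
  assumes "\<And>N m. m \<le> int N \<Longrightarrow> fls_nth (S N) m = fls_nth G m"
  shows "S \<longlonglongrightarrow> G"
proof (rule metric_tendsto_imp_tendsto)
  show "(\<lambda>N. inverse (2 ^ N) :: real) \<longlonglongrightarrow> 0"
    using LIMSEQ_inverse_realpow_zero [of 2] by simp
  show "\<forall>\<^sub>F N in sequentially. dist (S N) G \<le> dist (inverse (2 ^ N) :: real) 0"
  proof (rule always_eventually, rule allI)
    fix N
    show "dist (S N) G \<le> dist (inverse (2 ^ N) :: real) 0"
    proof (cases "S N = G")
      case False
      have "int N \<le> fls_subdegree (S N - G)"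
        using False assms [of _ N] by (intro fls_subdegree_geI) auto
      hence "N \<le> nat (fls_subdegree (S N - G))" "0 \<le> fls_subdegree (S N - G)"
        by linarith+
      thus ?thesis using False
        by (simp add: dist_fls_def)
    qed simp
  qed
qed

lemma fls_sums_tail:
  fixes G :: "'a::field_char_0 fls"
  assumes "\<And>m. m \<le> int n \<Longrightarrow> fls_nth G m = 0"
  shows "(\<lambda>k. fls_const (fls_nth G (int (n + k) + 1)) / fls_X_inv ^ (n + k + 1)) sums G"
  unfolding sums_def
proof (rule LIMSEQ_fls_I)
  fix N m assume m: "m \<le> int N"
  have "fls_nth (\<Sum>k<N. fls_const (fls_nth G (int (n + k) + 1)) / fls_X_inv ^ (n + k + 1)) m =
      (\<Sum>k<N. if m = int (n + k) + 1 then fls_nth G m else 0)"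
    unfolding fls_nth_sum by (intro sum.cong) (simp_all add: fls_divide_X_inv_power del: power_Suc)
  also have "\<dots> = (\<Sum>k<N. if k = nat (m - 1 - int n) \<and> m \<ge> int n + 1 then fls_nth G m else 0)"
    by (intro sum.cong) auto
  also have "\<dots> = fls_nth G m"
    using m assms [of m] by (cases "m \<ge> int n + 1") (auto simp: sum.delta)
  finally show "fls_nth (\<Sum>k<N. fls_const (fls_nth G (int (n + k) + 1)) /
      fls_X_inv ^ (n + k + 1)) m = fls_nth G m" .
qed

theorem proposition5p7:
  fixes L :: "'a::field_char_0 weyl" and d :: nat
  assumes "L \<noteq> 0"
    and "d = fls_vs.dim (V1 L)"
    and "d > 0"
  shows "(\<forall>n>0. weyl_left_ideal (I_ideal n L) \<and> I_ideal n L \<noteq> {0}) \<and>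
    (\<forall>n>0. \<forall>f A R P Q.
       is_basis_V1 L d f \<longrightarrow>
       R \<in> I_ideal n L - {0} \<longrightarrow>
       P = weyl_act_poly (weyl_adjoint R) A \<longrightarrow>
       (\<forall>j\<in>{1..d}. Q j = phi_ext (f j) (diff_quot P)) \<longrightarrow>
       P \<noteq> 0 \<longrightarrow>
         pade_type_approximant n d f P Q \<and>
         (\<forall>j\<in>{1..d}.
            (\<lambda>k. fls_const (phi (f j) (monom 1 (n + k) * P)) / fls_X_inv ^ (n + k + 1))
              sums (poly_fls P * f j - poly_fls (Q j))))"
proof (intro conjI allI impI)
  fix n show "weyl_left_ideal (I_ideal n L)" by (rule weyl_left_ideal_I_ideal)
  show "I_ideal n L \<noteq> {0}" using assms(1) assms(3) [unfolded assms(2)] by (rule I_ideal_nonzero)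
next
  fix n f A R P Q
  assume f: "is_basis_V1 L d f" and R: "R \<in> I_ideal n L - {0}"
    and P: "P = weyl_act_poly (weyl_adjoint R) A"
    and Q: "\<forall>j\<in>{1..d}. Q j = phi_ext (f j) (diff_quot P)"
  let ?G = "\<lambda>j. poly_fls P * f j - poly_fls (Q j)"
  have V1: "f j \<in> V1 L" if "j \<in> {1..d}" for j
    using f that fls_vs.span_superset unfolding is_basis_V1_def by blast
  hence zinv: "f j \<in> zinv_series" if "j \<in> {1..d}" for j
    using that by (auto simp: V1_def)
  have nth: "fls_nth (?G j) (int k + 1) = phi (f j) (monom 1 k * P)" if "j \<in> {1..d}" for j k
    using fls_nth_remainder [of P "f j" k] Q that by simp
  have vanish: "fls_nth (?G j) m = 0" if j: "j \<in> {1..d}" and m: "m \<le> int n" for j m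
  proof (cases "m \<le> 0")
    case True
    thus ?thesis using remainder_in_zinv_series [OF zinv [OF j]] Q j
      by (simp add: zinv_series_def)
  next
    case False
    then obtain k where k: "m = int k + 1"
      by (metis add.commute zero_less_imp_eq_int not_le gr0_conv_Suc of_nat_Suc)
    hence "k < n" using m by simp
    thus ?thesis using nth [OF j, of k] phi_orthogonal [OF V1 [OF j], of R n k A] R by (simp add: k P)
  qed
  show "\<forall>j\<in>{1..d}.
      (\<lambda>k. fls_const (phi (f j) (monom 1 (n + k) * P)) / fls_X_inv ^ (n + k + 1)) sums ?G j"
  proof
    fix j assume j: "j \<in> {1..d}"
    show "(\<lambda>k. fls_const (phi (f j) (monom 1 (n + k) * P)) / fls_X_inv ^ (n + k + 1)) sums ?G j"
      using fls_sums_tail [OF vanish [OF j]] unfolding nth [OF j] .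
  qed
  have "Fin (int n + 1) \<le> ord_inf (?G j)" if "j \<in> {1..d}" for j
    using vanish [OF that] by (auto simp: ord_inf_def intro!: fls_subdegree_geI)
  thus "pade_type_approximant n d f P Q"
    unfolding pade_type_approximant_def by (intro exI [of _ "max (degree P) (d * n)"] conjI ballI) simp_all
qed

end
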